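(* Let $F_0\in\mathbb{R}^3$ (column vector), $F,G_1,G_2\in\mathbb{R}^{3\times 3}$ and $H_1,H_2\in\mathbb{R}^{1\times 3}$ (row vectors) be the coefficients of the bilinear quantum stochastic differential equation $$dx=F_0\,dt+Fx\,dt+G_1x\,d\bar W_1+G_2x\,d\bar W_2$$ with output equation $$\begin{pmatrix} d\bar Y_1\\ d\bar Y_2\end{pmatrix}=\begin{pmatrix}H_1\\H_2\end{pmatrix}x\,dt+\begin{pmatrix} d\bar W_1\\ d\bar W_2\end{pmatrix}.$$ This system is physically realizable if and only if all of the following hold: (i) $F_0=\tfrac12\,(G_1+\mathbf{i}\,G_2)(H_1+\mathbf{i}H_2)^\dagger$; (ii) $G_1=\Theta(H_2)$; (iii) $G_2=-\Theta(H_1)$; (iv) $F+F^T+G_1G_1^T+G_2G_2^T=0$. In that case, the matrix $\alpha$ defining the system Hamiltonian can be identified as $$\alpha=\tfrac18\,\mathrm{vec}(F-F^T)^T E,$$ and the coupling matrix can be identified as $\Lambda=\tfrac12(H_1+\mathbf{i}H_2)$ (that is, this $\alpha$ and $\Lambda$ satisfy the equations in the definition of physical realizability).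
   Context: $\mathbf{i}$ is the imaginary unit. For a complex vector or matrix $M$, $M^T$ is the transpose, $M^\#$ the entrywise complex conjugate, $M^\dagger=(M^\#)^T$ the conjugate transpose; $I$ is the identity matrix. For $\beta\in\mathbb{C}^3$ (a row or a column vector) define $$\Theta(\beta)=\begin{pmatrix}0&\beta_3&-\beta_2\\-\beta_3&0&\beta_1\\ \beta_2&-\beta_1&0\end{pmatrix}.$$ $\mathrm{vec}$ is the column-stacking operator, sending a matrix to the column vector formed by stacking its columns below one another. $E\in\mathbb{R}^{9\times 3}$ is the block column $$E=\begin{pmatrix}\bar e_1\\ \bar e_2\\ \bar e_3\end{pmatrix},\quad \bar e_1=\begin{pmatrix}0&0&0\\0&0&1\\0&-1&0\end{pmatrix},\ \bar e_2=\begin{pmatrix}0&0&-1\\0&0&0\\1&0&0\end{pmatrix},\ \bar e_3=\begin{pmatrix}0&1&0\\-1&0&0\\0&0&0\end{pmatrix}.$$ Here $x=(x_1,x_2,x_3)^T$ is the vector of (self-adjoint) spin operators of an open two-level quantum system, and $\bar W_1,\bar W_2$ (inputs) and $\bar Y_1,\bar Y_2$ (outputs) are quadrature boson fields. Definition (physically realizable). The system with coefficients $(F_0,F,G_1,G_2,H_1,H_2)$ is physically realizable if there exist a Hamiltonian $\mathcal H=\alpha x$ with $\alpha\in\mathbb{R}^{1\times3}$ and a coupling operator $L=\Lambda x$ with $\Lambda\in\mathbb{C}^{1\times 3}$ (row vectors) such that $$F_0=-2\mathbf{i}\,\Theta(\Lambda)\Lambda^\dagger,\qquad F=-2\Theta(\alpha)+\Lambda^\dagger\Lambda+\Lambda^T\Lambda^\#-2\Lambda\Lambda^\dagger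 I,$$ $$G_1=\Theta\big(\mathbf{i}(\Lambda^\#-\Lambda)\big),\qquad G_2=-\Theta(\Lambda+\Lambda^\#),\qquad H_1=\Lambda+\Lambda^\#,\qquad H_2=\mathbf{i}(\Lambda^\#-\Lambda).$$ (Here $\Lambda\Lambda^\dagger$ is a scalar.) Physical realizability is thus a condition on the coefficient matrices only. *)

theory Defs
  imports "HOL-Analysis.Analysis"
begin

(* A k x n matrix over 'a has type 'a^n^k; row vectors are 1 x 3 matrices ('a^3^1) and
   column vectors are 3 x 1 matrices ('a^1^3), so that all products are matrix products **.
   Entrywise multiplication by a scalar is spelled out here because the library's
   *s, applied to a matrix, expects a row as its left operand. *)

definition mscale :: "'a::times \<Rightarrow> 'a^'n^'m \<Rightarrow> 'a^'n^'m"  (infixr \<open>*\<^sub>m\<close> 75)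
  where "c *\<^sub>m M = map_matrix (\<lambda>a. c * a) M"

definition mconj :: "complex^'n^'m \<Rightarrow> complex^'n^'m"
  where "mconj M = map_matrix cnj M"

definition dagger :: "complex^'n^'m \<Rightarrow> complex^'m^'n"
  where "dagger M = transpose (mconj M)"

definition cmat :: "real^'n^'m \<Rightarrow> complex^'n^'m"
  where "cmat M = map_matrix complex_of_real M"

definition Theta :: "'a::ring_1^3^1 \<Rightarrow> 'a^3^3"
  where "Theta b = vector
    [vector [0, b$1$3, - b$1$2],
     vector [- b$1$3, 0, b$1$1],
     vector [b$1$2, - b$1$1, 0]]"

(* Block column of three matrices with three rows each. *)
definition stack3 :: "'a::zero^'n^3 \<Rightarrow> 'a^'n^3 \<Rightarrow> 'a^'n^3 \<Rightarrow> 'a^'n^9"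
  where "stack3 A B C = vector [A$1, A$2, A$3, B$1, B$2, B$3, C$1, C$2, C$3]"

(* The column-stacking operator vec; the library's constant vec is something else. *)
definition vec_cols :: "'a::zero^3^3 \<Rightarrow> 'a^1^9"
  where "vec_cols M = stack3 (columnvector (column 1 M))
                             (columnvector (column 2 M))
                             (columnvector (column 3 M))"

definition E_mat :: "real^3^9"
  where "E_mat = stack3
    (vector [vector [0, 0, 0], vector [0, 0, 1], vector [0, - 1, 0]])
    (vector [vector [0, 0, - 1], vector [0, 0, 0], vector [1, 0, 0]])
    (vector [vector [0, 1, 0], vector [- 1, 0, 0], vector [0, 0, 0]])"

(* The Hamiltonian alpha x and the coupling operator Lambda x enter only through
   their coefficient rows alpha (real) and Lambda (complex). The coefficients of the
   system are real; the equations are between complex matrices. *)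
definition realized_by ::
  "real^3^1 \<Rightarrow> complex^3^1 \<Rightarrow>
   real^1^3 \<Rightarrow> real^3^3 \<Rightarrow> real^3^3 \<Rightarrow> real^3^3 \<Rightarrow> real^3^1 \<Rightarrow> real^3^1 \<Rightarrow> bool"
  where "realized_by \<alpha> \<Lambda> F0 F G1 G2 H1 H2 \<longleftrightarrow>
    cmat F0 = (- 2 * \<i>) *\<^sub>m (Theta \<Lambda> ** dagger \<Lambda>) \<and>
    cmat F = (- 2) *\<^sub>m Theta (cmat \<alpha>) + dagger \<Lambda> ** \<Lambda> + transpose \<Lambda> ** mconj \<Lambda>
             - (2 * (\<Lambda> ** dagger \<Lambda>) $ 1 $ 1) *\<^sub>m mat 1 \<and>
    cmat G1 = Theta (\<i> *\<^sub>m (mconj \<Lambda> - \<Lambda>)) \<and>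
    cmat G2 = - Theta (\<Lambda> + mconj \<Lambda>) \<and>
    cmat H1 = \<Lambda> + mconj \<Lambda> \<and>
    cmat H2 = \<i> *\<^sub>m (mconj \<Lambda> - \<Lambda>)"

definition physically_realizable ::
  "real^1^3 \<Rightarrow> real^3^3 \<Rightarrow> real^3^3 \<Rightarrow> real^3^3 \<Rightarrow> real^3^1 \<Rightarrow> real^3^1 \<Rightarrow> bool"
  where "physically_realizable F0 F G1 G2 H1 H2 \<longleftrightarrow>
    (\<exists>\<alpha> \<Lambda>. realized_by \<alpha> \<Lambda> F0 F G1 G2 H1 H2)"

end

(* The output equations of realized_by say exactly that \<Lambda> = (H1 + i H2)/2; with this \<Lambda> the
   equations for F0, G1, G2 turn into (i)-(iii). The real form of the equation for F is
   F = - 2 \<Theta>(\<alpha>) + S, where S is symmetric and, by \<Theta>(b) \<Theta>(b)^T = |b|^2 I - b^T b,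
   2 S = - (G1 G1^T + G2 G2^T). Thus (iv) is the symmetric part of that equation, while its
   antisymmetric part F - F^T = - 4 \<Theta>(\<alpha>) can always be solved for \<alpha>. *)
theory Submission
  imports Defs
begin

lemma sum_9: "sum f (UNIV::9 set) = f 1 + f 2 + f 3 + f 4 + f 5 + f 6 + f 7 + f 8 + f 9"
  for f :: "9 \<Rightarrow> 'a::comm_monoid_add"
proof -
  \<comment> \<open>In type \<open>9\<close> the numeral \<open>9\<close> is 0, so the nine numerals
    are distinct and exhaust the type.\<close>
  have "card {1,2,3,4,5,6,7,8,9::9} = CARD(9)" by simp
  then have U: "(UNIV::9 set) = {1,2,3,4,5,6,7,8,9}" by (metis card_subset_eq finite subset_UNIV)
  show ?thesis unfolding U by (simp add: add.assoc)
qed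

lemma vector_9:
  fixes a :: "'a::zero"
  shows "(vector [a,b,c,d,e,f,g,h,k] :: 'a^9) $ 1 = a"
    and "(vector [a,b,c,d,e,f,g,h,k] :: 'a^9) $ 2 = b"
    and "(vector [a,b,c,d,e,f,g,h,k] :: 'a^9) $ 3 = c"
    and "(vector [a,b,c,d,e,f,g,h,k] :: 'a^9) $ 4 = d"
    and "(vector [a,b,c,d,e,f,g,h,k] :: 'a^9) $ 5 = e"
    and "(vector [a,b,c,d,e,f,g,h,k] :: 'a^9) $ 6 = f"
    and "(vector [a,b,c,d,e,f,g,h,k] :: 'a^9) $ 7 = g"
    and "(vector [a,b,c,d,e,f,g,h,k] :: 'a^9) $ 8 = h"
    and "(vector [a,b,c,d,e,f,g,h,k] :: 'a^9) $ 9 = k"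
  unfolding vector_def by simp_all

lemma mscale_nth [simp]: "(c *\<^sub>m M) $ i $ j = c * M $ i $ j"
  by (simp add: mscale_def map_matrix_def)

lemma mconj_nth [simp]: "mconj M $ i $ j = cnj (M $ i $ j)"
  by (simp add: mconj_def map_matrix_def)

lemma cmat_nth [simp]: "cmat M $ i $ j = complex_of_real (M $ i $ j)"
  by (simp add: cmat_def map_matrix_def)

lemma dagger_nth [simp]: "dagger M $ i $ j = cnj (M $ j $ i)"
  by (simp add: dagger_def transpose_def)

lemma cmat_eq_iff [simp]: "cmat A = cmat B \<longleftrightarrow> A = B"
  by (simp add: vec_eq_iff)

lemma cmat_uminus: "cmat (- A) = - cmat A"
  by (simp add: vec_eq_iff)

lemma Theta_cmat: "Theta (cmat b) = cmat (Theta b)"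
  by (simp add: vec_eq_iff forall_3 Theta_def)

text \<open>Column k of \<open>E_mat\<close> stacks the columns of - \<open>Theta\<close> of the
  k-th unit row, so the product only sees the antisymmetric part of \<open>M\<close>.\<close>

lemma transpose_vec_cols_E_mat:
  "transpose (vec_cols M) ** E_mat = vector [vector [M$3$2 - M$2$3, M$1$3 - M$3$1, M$2$1 - M$1$2]]"
  by (simp add: vec_eq_iff forall_3 forall_1 matrix_matrix_mult_def transpose_def sum_9
      vec_cols_def E_mat_def stack3_def columnvector_def column_def vector_9)

text \<open>The matrix S of the overview: the \<Lambda> terms of the equation for \<open>F\<close>,
  written in real terms.\<close>

definition drift_sym :: "real^3^1 \<Rightarrow> real^3^1 \<Rightarrow> real^3^3"
  where "drift_sym H1 H2 = (1/2) *\<^sub>m (transpose H1 ** H1 + transpose H2 ** H2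
    - ((H1 ** transpose H1 + H2 ** transpose H2) $ 1 $ 1) *\<^sub>m mat 1)"

text \<open>The first two products are conjugate to each other, so the cross terms of
  \<open>H1\<close> and \<open>H2\<close> cancel in their sum.\<close>

lemma cmat_drift_sym:
  fixes H1 H2 :: "real^3^1"
  defines "\<Lambda> \<equiv> (1/2) *\<^sub>m (cmat H1 + \<i> *\<^sub>m cmat H2)"
  shows "dagger \<Lambda> ** \<Lambda> + transpose \<Lambda> ** mconj \<Lambda> - (2 * (\<Lambda> ** dagger \<Lambda>) $ 1 $ 1) *\<^sub>m mat 1
    = cmat (drift_sym H1 H2)"
  by (simp add: \<Lambda>_def drift_sym_def vec_eq_iff forall_3 matrix_matrix_mult_def transpose_def
      sum_1 sum_3 mat_def complex_eq_iff algebra_simps)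

lemma drift_sym_Theta:
  "2 *\<^sub>m drift_sym H1 H2 = - (Theta H1 ** transpose (Theta H1)) - Theta H2 ** transpose (Theta H2)"
  by (simp add: drift_sym_def Theta_def vec_eq_iff forall_3 matrix_matrix_mult_def transpose_def
      sum_1 sum_3 mat_def algebra_simps)

text \<open>Entrywise, \<open>H1\<close> is twice the real part and \<open>H2\<close> twice the
  imaginary part of \<Lambda>.\<close>

lemma coupling_iff:
  "cmat H1 = \<Lambda> + mconj \<Lambda> \<and> cmat H2 = \<i> *\<^sub>m (mconj \<Lambda> - \<Lambda>)
    \<longleftrightarrow> \<Lambda> = (1/2) *\<^sub>m (cmat H1 + \<i> *\<^sub>m cmat H2)"
proof -
  have "complex_of_real a = l + cnj l \<and> complex_of_real b = \<i> * (cnj l - l)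
      \<longleftrightarrow> l = (1/2) * (complex_of_real a + \<i> * complex_of_real b)" for a b l
    by (auto simp: complex_eq_iff)
  then show ?thesis
    by (simp add: vec_eq_iff) blast
qed

text \<open>By linearity of \<open>Theta\<close>, the factor - 2 \<i> turns \<open>Theta\<close>
  \<Lambda> into \<open>Theta H2\<close> - \<i> \<open>Theta H1\<close>; the remaining 1/2 comes
  from \<open>dagger\<close> \<Lambda>.\<close>

lemma Theta_dagger_eq:
  fixes H1 H2 :: "real^3^1"
  defines "\<Lambda> \<equiv> (1/2) *\<^sub>m (cmat H1 + \<i> *\<^sub>m cmat H2)"
  shows "(- 2 * \<i>) *\<^sub>m (Theta \<Lambda> ** dagger \<Lambda>)
    = (1/2) *\<^sub>m ((cmat (Theta H2) + \<i> *\<^sub>m cmat (- Theta H1)) ** dagger (cmat H1 + \<i> *\<^sub>m cmat H2))"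
  by (simp add: \<Lambda>_def Theta_def vec_eq_iff forall_3 matrix_matrix_mult_def sum_3
      complex_eq_iff field_simps)

text \<open>Eliminates \<Lambda>, leaving \<alpha> as the only unknown, in a real equation.\<close>

lemma realized_by_iff:
  "realized_by \<alpha> \<Lambda> F0 F G1 G2 H1 H2 \<longleftrightarrow>
    \<Lambda> = (1/2) *\<^sub>m (cmat H1 + \<i> *\<^sub>m cmat H2) \<and>
    cmat F0 = (1/2) *\<^sub>m ((cmat G1 + \<i> *\<^sub>m cmat G2) ** dagger (cmat H1 + \<i> *\<^sub>m cmat H2)) \<and>
    F = (- 2) *\<^sub>m Theta \<alpha> + drift_sym H1 H2 \<and> G1 = Theta H2 \<and> G2 = - Theta H1"
proof -
  let ?L = "(1/2) *\<^sub>m (cmat H1 + \<i> *\<^sub>m cmat H2)"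
  have F: "cmat F = (- 2) *\<^sub>m Theta (cmat \<alpha>) + cmat (drift_sym H1 H2)
      \<longleftrightarrow> F = (- 2) *\<^sub>m Theta \<alpha> + drift_sym H1 H2"
  proof -
    have "(- 2) *\<^sub>m Theta (cmat \<alpha>) + cmat (drift_sym H1 H2)
        = cmat ((- 2) *\<^sub>m Theta \<alpha> + drift_sym H1 H2)"
      by (simp add: Theta_cmat vec_eq_iff)
    then show ?thesis by simp
  qed
  have outputs: "?L + mconj ?L = cmat H1" "\<i> *\<^sub>m (mconj ?L - ?L) = cmat H2"
    using coupling_iff[of H1 ?L H2] by simp_all
  have G: "cmat G1 = Theta (cmat H2) \<longleftrightarrow> G1 = Theta H2"
    "cmat G2 = - Theta (cmat H1) \<longleftrightarrow> G2 = - Theta H1"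
    by (simp_all add: Theta_cmat flip: cmat_uminus)
  show ?thesis
  proof (cases "\<Lambda> = ?L")
    case True
    show ?thesis
      \<comment> \<open>Sums are regrouped to the right so that the \<Lambda> terms stand together
        and match \<open>cmat_drift_sym\<close>.\<close>
      unfolding True realized_by_def add_diff_eq[symmetric] outputs add.assoc
        cmat_drift_sym[unfolded add_diff_eq[symmetric]] F G
      by (auto simp only: Theta_dagger_eq)
  next
    case False
    \<comment> \<open>Both sides are false here, the left one by its output equations.\<close>
    with coupling_iff[of H1 \<Lambda> H2] show ?thesis
      by (auto simp: realized_by_def)
  qed
qed

lemma transpose_add: "transpose (A + B) = transpose A + transpose B"
  by (simp add: transpose_def vec_eq_iff)

lemma transpose_mscale: "transpose (c *\<^sub>m A) = c *\<^sub>m transpose A"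
  by (simp add: transpose_def vec_eq_iff)

lemma transpose_Theta: "transpose (Theta b) = - Theta b"
  by (simp add: Theta_def vec_eq_iff forall_3 transpose_def)

lemma transpose_drift_sym: "transpose (drift_sym H1 H2) = drift_sym H1 H2"
  by (simp add: drift_sym_def vec_eq_iff forall_3 matrix_matrix_mult_def transpose_def sum_1
      mat_def algebra_simps)

text \<open>Explains the constant 1/8: antisymmetry doubles each entry of the product with
  \<open>E_mat\<close>, and - 2/8 times 2 gives the factor 1/2 up to the sign in
  \<open>Theta\<close>.\<close>

lemma Theta_vec_cols_E_mat:
  fixes F :: "real^3^3"
  shows "(- 2) *\<^sub>m Theta ((1/8) *\<^sub>m (transpose (vec_cols (F - transpose F)) ** E_mat))
    = (1/2) *\<^sub>m (F - transpose F)"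
  unfolding transpose_vec_cols_E_mat
  by (simp add: Theta_def vec_eq_iff forall_3 transpose_def field_simps)

text \<open>The hypothesis makes \<open>S\<close> the symmetric part of \<open>F\<close>; the
  \<open>Theta\<close> term supplies the antisymmetric part.\<close>

lemma hamiltonian_solvable:
  fixes F S :: "real^3^3"
  assumes "F + transpose F = 2 *\<^sub>m S"
  shows "F = (- 2) *\<^sub>m Theta ((1/8) *\<^sub>m (transpose (vec_cols (F - transpose F)) ** E_mat)) + S"
proof -
  have "F $ i $ j = (1/2) * (F $ i $ j - F $ j $ i) + S $ i $ j" for i j
  proof -
    have "(F + transpose F) $ i $ j = (2 *\<^sub>m S) $ i $ j"
      using assms by simp
    then show ?thesis
      by (simp add: transpose_def field_simps)
  qed
  then show ?thesis
    unfolding Theta_vec_cols_E_mat by (simp add: vec_eq_iff transpose_def)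
qed

theorem theorem1:
  fixes F0 :: "real^1^3"
    and F G1 G2 :: "real^3^3"
    and H1 H2 :: "real^3^1"
  shows "(physically_realizable F0 F G1 G2 H1 H2 \<longleftrightarrow>
            cmat F0 = (1/2) *\<^sub>m ((cmat G1 + \<i> *\<^sub>m cmat G2) ** dagger (cmat H1 + \<i> *\<^sub>m cmat H2)) \<and>
            G1 = Theta H2 \<and>
            G2 = - Theta H1 \<and>
            F + transpose F + G1 ** transpose G1 + G2 ** transpose G2 = 0) \<and>
         (physically_realizable F0 F G1 G2 H1 H2 \<longrightarrow>
            realized_by
              ((1/8) *\<^sub>m (transpose (vec_cols (F - transpose F)) ** E_mat))
              ((1/2) *\<^sub>m (cmat H1 + \<i> *\<^sub>m cmat H2))
              F0 F G1 G2 H1 H2)"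
proof -
  let ?a = "(1/8) *\<^sub>m (transpose (vec_cols (F - transpose F)) ** E_mat)"
  let ?L = "(1/2) *\<^sub>m (cmat H1 + \<i> *\<^sub>m cmat H2)"
  let ?i = "cmat F0 = (1/2) *\<^sub>m ((cmat G1 + \<i> *\<^sub>m cmat G2) ** dagger (cmat H1 + \<i> *\<^sub>m cmat H2))"
  let ?iv = "F + transpose F + G1 ** transpose G1 + G2 ** transpose G2 = 0"
  have minus: "(- A) ** transpose (- A) = A ** transpose A" for A :: "real^3^3"
    by (simp add: vec_eq_iff matrix_matrix_mult_def transpose_def)
  have iv: "?iv \<longleftrightarrow> F + transpose F = 2 *\<^sub>m drift_sym H1 H2" if "G1 = Theta H2" "G2 = - Theta H1"
    unfolding drift_sym_Theta that minus by (simp only: eq_diff_eq eq_neg_iff_add_eq_0)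
  have nec: "?i \<and> G1 = Theta H2 \<and> G2 = - Theta H1 \<and> ?iv"
    if pr: "physically_realizable F0 F G1 G2 H1 H2"
  proof -
    obtain \<alpha> \<Lambda> where "realized_by \<alpha> \<Lambda> F0 F G1 G2 H1 H2"
      using pr unfolding physically_realizable_def by blast
    then have i: ?i and F: "F = (- 2) *\<^sub>m Theta \<alpha> + drift_sym H1 H2"
      and G: "G1 = Theta H2" "G2 = - Theta H1"
      unfolding realized_by_iff by simp_all
    \<comment> \<open>Transposition flips the sign of the Hamiltonian term only, so \<alpha> cancels
      in \<open>F + transpose F\<close>.\<close>
    have "transpose F = 2 *\<^sub>m Theta \<alpha> + drift_sym H1 H2"
      unfolding F transpose_add transpose_mscale transpose_Theta transpose_drift_sym
      by (simp add: vec_eq_iff)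
    then have "F + transpose F = 2 *\<^sub>m drift_sym H1 H2"
      by (simp add: F vec_eq_iff)
    with iv[OF G] have ?iv by (rule iffD2)
    with i G show ?thesis by (intro conjI)
  qed
  \<comment> \<open>The explicit pair serves twice: as witness for realizability and, through
    \<open>nec\<close>, as the claimed identification.\<close>
  have suf: "realized_by ?a ?L F0 F G1 G2 H1 H2"
    if "?i" "G1 = Theta H2" "G2 = - Theta H1" "?iv"
    unfolding realized_by_iff
    using that(1-3) hamiltonian_solvable[OF iffD1[OF iv[OF that(2,3)] that(4)]]
    by (intro conjI refl)
  show ?thesis
    using nec suf unfolding physically_realizable_def by (intro conjI iffI impI exI) blast+
qed

end
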